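(* Let $\beta$ be an optimal basis for P with associated dual basic solution $\bar y^{\top}=c_\beta^{\top}A_\beta^{-1}$, let $i\in\mathcal I$ with $\bar y_i\notin\mathbb{Z}$, let $h_{\cdot i}$ be the $i$-th column of $A_\beta^{-1}$, and let $r\in\mathbb{Z}^m$ satisfy $r\ge -h_{\cdot i}$ and $r\ge\mathbf 0$. Then the inequality $$y^{\top}\bigl(A_\beta r-(\bar y_i-\lfloor\bar y_i\rfloor-1)e_i\bigr)\le c_\beta^{\top}r-(\bar y_i-\lfloor\bar y_i\rfloor-1)\lfloor\bar y_i\rfloor$$ is valid for (i.e., satisfied by every point of) the following relaxation of the feasible region of $\mbox{D}_{\mathcal I}$: $$\{y\in\mathbb{R}^m : y^{\top}A_\beta\le c_\beta^{\top},\ y_i\ge\lceil\bar y_i\rceil\}\cup\{y\in\mathbb{R}^m : y^{\top}A_\beta\le c_\beta^{\top},\ y_i\le\lfloor\bar y_i\rfloor\}.$$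
   Context: Let $A\in\mathbb{Z}^{m\times n}$, $c\in\mathbb{Z}^n$, $b\in\mathbb{R}^m$, and let $\mathcal I\subseteq\{1,\ldots,m\}$ be nonempty. $\mbox{D}_{\mathcal I}$ is the problem: maximize $y^{\top}b$ subject to $y^{\top}A\le c^{\top}$, $y\in\mathbb{R}^m$, $y_i\in\mathbb{Z}$ for $i\in\mathcal I$. D is its continuous relaxation, and P is the dual of D: minimize $c^{\top}x$ subject to $Ax=b$, $x\ge\mathbf 0$. A basis $\beta$ is an ordered list of $m$ column indices such that the submatrix $A_\beta$ of the corresponding columns of $A$ is invertible; $c_\beta$ is the corresponding subvector of $c$. The basis is optimal for P if $A_\beta^{-1}b\ge\mathbf 0$ and $\bar y^{\top}A\le c^{\top}$, where $\bar y^{\top}=c_\beta^{\top}A_\beta^{-1}$. $e_i$ denotes the $i$-th standard unit vector of $\mathbb{R}^m$. *)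

theory Defs
  imports "HOL-Analysis.Analysis"
begin

text \<open>
  The row index set is a finite type \<open>'m\<close>, the column index set a finite type \<open>'n\<close>.
  Inequalities between vectors are the componentwise ones of the library, and the row vector
  obtained by multiplying the transpose of \<open>y\<close> with \<open>A\<close> is \<open>y v* A\<close>.
\<close>

definition real_vec :: "int ^ 'k \<Rightarrow> real ^ 'k" where
  "real_vec v = (\<chi> k. real_of_int (v $ k))"

definition real_mat :: "int ^ 'n ^ 'm \<Rightarrow> real ^ 'n ^ 'm" where
  "real_mat A = (\<chi> j k. real_of_int (A $ j $ k))"

text \<open>
  An ordered list of \<open>CARD('m)\<close> column indices is a function \<open>\<beta> :: 'm \<Rightarrow> 'n\<close>, the list positions
  being labelled by \<open>'m\<close>. Hence the submatrix of the columns listed in \<open>\<beta>\<close> is square, and its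
  inverse has rows labelled by list positions and columns labelled by the rows of \<open>A\<close>.
\<close>

definition basis_matrix :: "int ^ 'n ^ 'm \<Rightarrow> ('m \<Rightarrow> 'n) \<Rightarrow> real ^ 'm ^ 'm" where
  "basis_matrix A \<beta> = (\<chi> j k. real_of_int (A $ j $ \<beta> k))"

definition basis_cost :: "int ^ 'n \<Rightarrow> ('m \<Rightarrow> 'n) \<Rightarrow> real ^ 'm" where
  "basis_cost c \<beta> = (\<chi> k. real_of_int (c $ \<beta> k))"

definition is_basis :: "int ^ 'n ^ 'm \<Rightarrow> ('m \<Rightarrow> 'n) \<Rightarrow> bool" where
  "is_basis A \<beta> \<longleftrightarrow> invertible (basis_matrix A \<beta>)"

definition dual_basic_solution :: "int ^ 'n ^ 'm \<Rightarrow> int ^ 'n \<Rightarrow> ('m \<Rightarrow> 'n) \<Rightarrow> real ^ 'm" where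
  "dual_basic_solution A c \<beta> = basis_cost c \<beta> v* matrix_inv (basis_matrix A \<beta>)"

text \<open>Optimality of a basis for the problem: minimize \<open>c \<bullet> x\<close> subject to \<open>A *v x = b\<close>, \<open>x \<ge> 0\<close>.\<close>

definition optimal_basis ::
  "int ^ 'n ^ 'm \<Rightarrow> real ^ 'm \<Rightarrow> int ^ 'n \<Rightarrow> ('m \<Rightarrow> 'n) \<Rightarrow> bool" where
  "optimal_basis A b c \<beta> \<longleftrightarrow>
     is_basis A \<beta> \<and>
     matrix_inv (basis_matrix A \<beta>) *v b \<ge> 0 \<and>
     dual_basic_solution A c \<beta> v* real_mat A \<le> real_vec c"

text \<open>
  Feasible region of the mixed-integer problem: maximize \<open>y \<bullet> b\<close> subject to
  \<open>y v* A \<le> c\<close> and \<open>y $ i\<close> integral for \<open>i \<in> I\<close>.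
\<close>

definition mixed_integer_feasible ::
  "int ^ 'n ^ 'm \<Rightarrow> int ^ 'n \<Rightarrow> 'm set \<Rightarrow> (real ^ 'm) set" where
  "mixed_integer_feasible A c I =
     {y. y v* real_mat A \<le> real_vec c \<and> (\<forall>i\<in>I. y $ i \<in> \<int>)}"

definition split_relaxation ::
  "int ^ 'n ^ 'm \<Rightarrow> int ^ 'n \<Rightarrow> ('m \<Rightarrow> 'n) \<Rightarrow> 'm \<Rightarrow> (real ^ 'm) set" where
  "split_relaxation A c \<beta> i =
     {y. y v* basis_matrix A \<beta> \<le> basis_cost c \<beta> \<and>
         y $ i \<ge> of_int \<lceil>dual_basic_solution A c \<beta> $ i\<rceil>} \<union>
     {y. y v* basis_matrix A \<beta> \<le> basis_cost c \<beta> \<and>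
         y $ i \<le> of_int \<lfloor>dual_basic_solution A c \<beta> $ i\<rfloor>}"

end

theory Submission
  imports Defs
begin

text \<open>
  Let \<open>s = c\<^sub>\<beta> - y v* A\<^sub>\<beta> \<ge> 0\<close> be the slack of \<open>y\<close>, \<open>f\<close> the fractional part of \<open>ybar $ i\<close> and
  \<open>t = y $ i - \<lfloor>ybar $ i\<rfloor>\<close>. The inequality is equivalent to \<open>(1 - f) * t \<le> s \<bullet> r\<close>.
  If \<open>t \<le> 0\<close>, it holds since \<open>s \<bullet> r \<ge> 0\<close>. If \<open>t \<ge> 1\<close>, then
  \<open>s \<bullet> r \<ge> - (s \<bullet> h) = y $ i - ybar $ i = t - f \<ge> (1 - f) * t\<close>.
\<close>

lemma inner_vec_nonneg:
  fixes u v :: "real ^ 'k"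
  assumes "0 \<le> u" "0 \<le> v"
  shows "0 \<le> u \<bullet> v"
  using assms by (auto simp: inner_vec_def less_eq_vec_def intro!: sum_nonneg)

text \<open>Pairing a row vector with column \<open>i\<close> of the inverse reads off entry
  \<open>i\<close> of its product with the inverse, and there \<open>B\<close> cancels against
  \<open>matrix_inv B\<close>. With \<open>d\<close> the basic cost, this turns slack times
  \<open>h\<close> into a difference of \<open>i\<close>-th coordinates.\<close>

lemma inner_column_matrix_inv:
  fixes B :: "real ^ 'm ^ 'm"
  assumes "invertible B"
  shows "(d - y v* B) \<bullet> column i (matrix_inv B) = (d v* matrix_inv B) $ i - y $ i"
proof -
  have inv: "B ** matrix_inv B = mat 1"
    using assms unfolding invertible_def matrix_inv_def by (rule someI_ex[THEN conjunct1])
  have "(d - y v* B) \<bullet> column i (matrix_inv B) = ((d - y v* B) v* matrix_inv B) \<bullet> axis i 1"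
    by (simp add: dot_lmul_matrix matrix_vector_mult_basis)
  also have "\<dots> = (d v* matrix_inv B) $ i - y $ i"
    by (simp add: inner_axis vector_matrix_mult_diff_distrib vector_matrix_mul_assoc inv)
  finally show ?thesis .
qed

text \<open>The basic constraints are among those of \<open>A\<close>, and no integer lies strictly
  between the floor and the ceiling of a real number.\<close>

lemma mixed_integer_feasible_subset_split_relaxation:
  assumes "i \<in> I"
  shows "mixed_integer_feasible A c I \<subseteq> split_relaxation A c \<beta> i"
proof
  fix y assume y: "y \<in> mixed_integer_feasible A c I"
  have "(y v* basis_matrix A \<beta>) $ k = (y v* real_mat A) $ \<beta> k" for k
    by (simp add: vector_matrix_mult_def basis_matrix_def real_mat_def)
  then have le: "y v* basis_matrix A \<beta> \<le> basis_cost c \<beta>"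
    using y by (simp add: mixed_integer_feasible_def less_eq_vec_def basis_cost_def real_vec_def)
  obtain z where z: "y $ i = of_int z"
    using y assms by (auto simp: mixed_integer_feasible_def elim: Ints_cases)
  let ?q = "dual_basic_solution A c \<beta> $ i"
  have "\<lceil>?q\<rceil> \<le> z \<or> z \<le> \<lfloor>?q\<rfloor>"
    by linarith
  then show "y \<in> split_relaxation A c \<beta> i"
    using le by (auto simp: split_relaxation_def z)
qed

theorem proposition5:
  fixes A :: "int ^ 'n ^ 'm" and c :: "int ^ 'n" and b :: "real ^ 'm"
    and I :: "'m set" and \<beta> :: "'m \<Rightarrow> 'n" and i :: 'm
    and r :: "int ^ 'm" and ybar h :: "real ^ 'm"
  assumes "I \<noteq> {}"
    and "optimal_basis A b c \<beta>"
    and "ybar = dual_basic_solution A c \<beta>"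
    and "i \<in> I" and "ybar $ i \<notin> \<int>"
    and "h = column i (matrix_inv (basis_matrix A \<beta>))"
    and "real_vec r \<ge> - h" and "r \<ge> 0"
  shows "mixed_integer_feasible A c I \<subseteq> split_relaxation A c \<beta> i \<and>
    (\<forall>y \<in> split_relaxation A c \<beta> i.
       y \<bullet> (basis_matrix A \<beta> *v real_vec r
             - (ybar $ i - of_int \<lfloor>ybar $ i\<rfloor> - 1) *\<^sub>R axis i 1)
       \<le> basis_cost c \<beta> \<bullet> real_vec r
          - (ybar $ i - of_int \<lfloor>ybar $ i\<rfloor> - 1) * of_int \<lfloor>ybar $ i\<rfloor>)"
proof (intro conjI ballI)
  show "mixed_integer_feasible A c I \<subseteq> split_relaxation A c \<beta> i"
    using \<open>i \<in> I\<close> by (rule mixed_integer_feasible_subset_split_relaxation)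
next
  fix y assume y: "y \<in> split_relaxation A c \<beta> i"
  define B where "B = basis_matrix A \<beta>"
  define d where "d = basis_cost c \<beta>"
  define s where "s = d - y v* B"
  define R where "R = real_vec r"
  define F where "F = real_of_int \<lfloor>ybar $ i\<rfloor>"
  define f where "f = ybar $ i - F"
  define t where "t = y $ i - F"
  have inv: "invertible B"
    using assms(2) by (simp add: optimal_basis_def is_basis_def B_def)
  have "0 \<le> s"
    using y by (auto simp: split_relaxation_def s_def B_def d_def less_eq_vec_def)
  have "0 \<le> R"
    using \<open>r \<ge> 0\<close> by (simp add: R_def less_eq_vec_def real_vec_def)
  \<comment> \<open>Nonnegativity of \<open>R + h\<close> allows pairing it with the slack:
    \<open>s \<bullet> (R + h)\<close> equals \<open>s \<bullet> R - (t - f)\<close>.\<close>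
  have "0 \<le> R $ k + h $ k" for k
    using \<open>real_vec r \<ge> - h\<close>[unfolded less_eq_vec_def, rule_format, of k] by (simp add: R_def)
  then have "0 \<le> R + h"
    by (simp add: less_eq_vec_def)
  have sR: "0 \<le> s \<bullet> R"
    using \<open>0 \<le> s\<close> \<open>0 \<le> R\<close> by (rule inner_vec_nonneg)
  have "s \<bullet> h = ybar $ i - y $ i"
    using inner_column_matrix_inv[OF inv]
    by (simp add: assms(3,6) s_def B_def d_def dual_basic_solution_def)
  moreover have "0 \<le> s \<bullet> (R + h)"
    using \<open>0 \<le> s\<close> \<open>0 \<le> R + h\<close> by (rule inner_vec_nonneg)
  ultimately have sRh: "t - f \<le> s \<bullet> R"
    by (simp add: inner_add_right t_def f_def)
  have f: "0 \<le> f" "f < 1"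
    unfolding f_def F_def by linarith+
  \<comment> \<open>Non-integrality enters here: the upper branch gives \<open>t \<ge> 1\<close>,
    not merely \<open>t \<ge> 0\<close>, and \<open>t \<ge> 1\<close> is what yields
    \<open>f \<le> f * t\<close> below.\<close>
  have ceil: "\<lceil>ybar $ i\<rceil> = \<lfloor>ybar $ i\<rfloor> + 1"
    using \<open>ybar $ i \<notin> \<int>\<close> by (auto simp: ceiling_altdef Ints_def)
  have "t \<ge> 1 \<or> t \<le> 0"
    using y ceil by (auto simp: split_relaxation_def t_def F_def simp flip: assms(3))
  then have key: "(1 - f) * t \<le> s \<bullet> R"
  proof
    assume "t \<ge> 1"
    then have "f * 1 \<le> f * t"
      using f by (intro mult_left_mono)
    then show ?thesis
      using sRh by (simp add: algebra_simps)
  next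
    assume "t \<le> 0"
    then have "(1 - f) * t \<le> 0"
      using f by (intro mult_nonneg_nonpos) auto
    then show ?thesis
      using sR by linarith
  qed
  have "y \<bullet> (B *v R) = d \<bullet> R - s \<bullet> R"
    by (simp add: s_def inner_diff_left dot_lmul_matrix)
  \<comment> \<open>Once \<open>d \<bullet> R\<close> cancels, what remains is
    \<open>(1 - f) * (y $ i - F) \<le> s \<bullet> R\<close>, which is \<open>key\<close>.\<close>
  then have "y \<bullet> (B *v R - (f - 1) *\<^sub>R axis i 1) \<le> d \<bullet> R - (f - 1) * F"
    using key by (simp add: inner_diff_right inner_axis t_def algebra_simps)
  then show "y \<bullet> (basis_matrix A \<beta> *v real_vec r
             - (ybar $ i - of_int \<lfloor>ybar $ i\<rfloor> - 1) *\<^sub>R axis i 1)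
       \<le> basis_cost c \<beta> \<bullet> real_vec r
          - (ybar $ i - of_int \<lfloor>ybar $ i\<rfloor> - 1) * of_int \<lfloor>ybar $ i\<rfloor>"
    by (simp add: B_def d_def R_def f_def F_def)
qed

end
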